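(* Let $N=\{1,\dots,n\}$, let $E,w_1,\dots,w_n$ be positive rational numbers with $E<\sum_{i\in N}w_i$, and let $(N,v^* )$ be the dual game of the bankruptcy game $\mathrm{BG}[E;w_1,\dots,w_n]$, i.e. $v^*(S)=\min\{E,\sum_{k\in S}w_k\}$ for all $S\subseteq N$. For a subset $S'\subseteq N$ with $|S'|\ge2$ and $\sum_{k\in S'}w_k>E$, let $(S',v^{*[S']})$ be the restricted game defined by $v^{*[S']}(S)=\min\{E,\sum_{k\in S}w_k\}$ for all $S\subseteq S'$. For every non-empty $S'\subseteq N$ define a vector $\phi^{*[S']}$ indexed by $S'$ by $$\phi^{*[S']}=\begin{cases}\text{the Shapley value of }(S',v^{*[S']}) & \text{if }|S'|\ge2\text{ and }\sum_{k\in S'}w_k>E,\\ (w_i)_{i\in S'} & \text{if }|S'|\ge2\text{ and }\sum_{k\in S'}w_k\le E,\\ v^*(\{k\}) & \text{if }S'=\{k\}.\end{cases}$$ Then for any $S'\subseteq N$ satisfying $|S'|\ge2$ and $\sum_{k\in S'}w_k>E$, and for all $i\in S'$, $$\phi^{*[S']}_i=\frac{1}{|S'|}\left(v^*(S')-v^*(S'\setminus\{i\})+\sum_{j\in S'\setminus\{i\}}\phi^{*[S'\setminus\{j\}]}_i\right).$$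
   Context: The bankruptcy game $\mathrm{BG}[E;w_1,\dots,w_n]$ is the cooperative game $(N,v)$ with $v(S)=\max\{0,\,E-\sum_{i\in N\setminus S}w_i\}$ for $S\subseteq N$; the dual game of $(N,v)$ is $(N,v^* )$ with $v^*(S)=v(N)-v(N\setminus S)$. The Shapley value of a game $(T,u)$ with finite non-empty player set $T$ is the vector with components $\frac{1}{|T|!}\sum_{\pi\in\Pi_T}\bigl(u(\mathrm{Prc}(\pi,i)\cup\{i\})-u(\mathrm{Prc}(\pi,i))\bigr)$, $i\in T$, where $\Pi_T$ is the set of all permutations (linear orderings) of $T$ and $\mathrm{Prc}(\pi,i)$ is the set of players of $T$ preceding $i$ in $\pi$. *)

theory Defs
  imports Complex_Main "HOL-Combinatorics.Multiset_Permutations"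
begin

text \<open>A game is given by its player set together with a characteristic function on sets of
  players; only the values on subsets of the player set are meaningful.\<close>

definition bankruptcy :: "'a set \<Rightarrow> rat \<Rightarrow> ('a \<Rightarrow> rat) \<Rightarrow> 'a set \<Rightarrow> rat" where
  "bankruptcy N E w S = max 0 (E - (\<Sum>i\<in>N - S. w i))"

definition dual_game :: "'a set \<Rightarrow> ('a set \<Rightarrow> rat) \<Rightarrow> 'a set \<Rightarrow> rat" where
  "dual_game N v S = v N - v (N - S)"

text \<open>Linear orderings of a finite player set are represented by the duplicate-free lists
  enumerating it.\<close>

definition Prc :: "'a list \<Rightarrow> 'a \<Rightarrow> 'a set" where
  "Prc \<pi> i = set (takeWhile (\<lambda>j. j \<noteq> i) \<pi>)"

definition shapley :: "'a set \<Rightarrow> ('a set \<Rightarrow> rat) \<Rightarrow> 'a \<Rightarrow> rat" where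
  "shapley T u i =
     1 / fact (card T) * (\<Sum>\<pi>\<in>permutations_of_set T. u (Prc \<pi> i \<union> {i}) - u (Prc \<pi> i))"

text \<open>The characteristic function of the restricted game on \<open>S'\<close>; its defining formula does not
  depend on \<open>S'\<close>, which enters only as the player set.\<close>

definition restricted_game :: "rat \<Rightarrow> ('a \<Rightarrow> rat) \<Rightarrow> 'a set \<Rightarrow> rat" where
  "restricted_game E w S = min E (\<Sum>k\<in>S. w k)"

text \<open>Meaningful for non-empty \<open>S' \<subseteq> N\<close> and \<open>i \<in> S'\<close>. In the last case \<open>S' = {i}\<close>.\<close>

definition phi_dual :: "'a set \<Rightarrow> rat \<Rightarrow> ('a \<Rightarrow> rat) \<Rightarrow> 'a set \<Rightarrow> 'a \<Rightarrow> rat" where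
  "phi_dual N E w S' i =
     (if card S' \<ge> 2 \<and> (\<Sum>k\<in>S'. w k) > E then shapley S' (restricted_game E w) i
      else if card S' \<ge> 2 \<and> (\<Sum>k\<in>S'. w k) \<le> E then w i
      else dual_game N (bankruptcy N E w) {i})"

text \<open>The dual of the bankruptcy game has the same closed form as the restricted games.\<close>

lemma dual_bankruptcy_eq:
  assumes "E > 0" and "S \<subseteq> N"
  shows "dual_game N (bankruptcy N E w) S = min E (\<Sum>k\<in>S. w k)"
proof -
  have "N - (N - S) = S" using assms(2) by blast
  then show ?thesis
    using assms(1) by (simp add: dual_game_def bankruptcy_def)
qed

end

theory Submission
  imports Defs
begin

text \<open>Grouping the orderings of \<open>T\<close> by their last player \<open>j\<close> gives a recursion for the Shapley
  value of any game: for \<open>j = i\<close> the marginal contribution of \<open>i\<close> is that to \<open>T - {i}\<close>, and for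
  \<open>j \<noteq> i\<close> one gets the Shapley value of the subgame on \<open>T - {j}\<close>. It remains to see that
  \<open>phi_dual\<close> agrees with the Shapley value of \<open>min E (\<Sum>k\<in>S. w k)\<close> in all three cases of
  its definition: in the last two, the marginal contributions of \<open>i\<close> are constant.\<close>

lemma permutations_of_set_snoc:
  assumes "T \<noteq> {}"
  shows "permutations_of_set T = (\<Union>j\<in>T. (\<lambda>xs. xs @ [j]) ` permutations_of_set (T - {j}))"
proof (intro set_eqI iffI)
  fix \<pi> assume \<pi>: "\<pi> \<in> permutations_of_set T"
  then have "\<pi> \<noteq> []" using assms by (auto simp: permutations_of_set_def)
  then obtain xs j where "\<pi> = xs @ [j]" by (metis append_butlast_last_id)
  with \<pi> show "\<pi> \<in> (\<Union>j\<in>T. (\<lambda>xs. xs @ [j]) ` permutations_of_set (T - {j}))"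
    by (auto simp: permutations_of_set_def)
next
  fix \<pi> assume "\<pi> \<in> (\<Union>j\<in>T. (\<lambda>xs. xs @ [j]) ` permutations_of_set (T - {j}))"
  then obtain j xs where "j \<in> T" "xs \<in> permutations_of_set (T - {j})" "\<pi> = xs @ [j]"
    by blast
  then show "\<pi> \<in> permutations_of_set T"
    by (simp add: permutations_of_set_def insert_absorb)
qed

text \<open>The families of orderings with different last players are disjoint, and appending a
  fixed player is injective, so nothing is counted twice.\<close>

lemma sum_permutations_of_set_snoc:
  assumes "finite T" and "T \<noteq> {}"
  shows "(\<Sum>\<pi>\<in>permutations_of_set T. f \<pi>) =
           (\<Sum>j\<in>T. \<Sum>\<pi>\<in>permutations_of_set (T - {j}). f (\<pi> @ [j]))"
  unfolding permutations_of_set_snoc[OF assms(2)]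
proof (subst sum.UNION_disjoint)
  show "(\<Sum>j\<in>T. sum f ((\<lambda>xs. xs @ [j]) ` permutations_of_set (T - {j}))) =
          (\<Sum>j\<in>T. \<Sum>\<pi>\<in>permutations_of_set (T - {j}). f (\<pi> @ [j]))"
    by (simp add: sum.reindex inj_on_def)
qed (use assms(1) in auto)

lemma Prc_subset: "Prc \<pi> i \<subseteq> set \<pi> - {i}"
  by (auto simp: Prc_def dest: set_takeWhileD)

text \<open>\<open>Prc\<close> only reads the list up to the first \<open>i\<close>: an entry
  appended after it is invisible, while an appended \<open>i\<close> has the whole old list before
  it.\<close>

lemma Prc_snoc:
  "i \<in> set \<pi> \<Longrightarrow> Prc (\<pi> @ [j]) i = Prc \<pi> i"
  "i \<notin> set \<pi> \<Longrightarrow> Prc (\<pi> @ [i]) i = set \<pi>"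
proof -
  show "Prc (\<pi> @ [j]) i = Prc \<pi> i" if "i \<in> set \<pi>"
    using that by (simp add: Prc_def takeWhile_append1)
  show "Prc (\<pi> @ [i]) i = set \<pi>" if "i \<notin> set \<pi>"
    using that by (subst Prc_def, subst takeWhile_append2) auto
qed

lemma shapley_recursion:
  assumes "finite T" and "i \<in> T"
  shows "shapley T u i =
           1 / of_nat (card T) * (u T - u (T - {i}) + (\<Sum>j\<in>T - {i}. shapley (T - {j}) u i))"
proof -
  define m where "m \<pi> = u (Prc \<pi> i \<union> {i}) - u (Prc \<pi> i)" for \<pi>
  \<comment> \<open>\<open>c\<close> is the size of every \<open>T - {j}\<close> with
    \<open>j\<close> in \<open>T\<close>, so each last player accounts for \<open>fact c\<close>
    orderings.\<close>
  define c where "c = card T - 1"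
  have c: "card T = Suc c"
    by (simp add: c_def card.remove[OF assms])
  have last_i: "(\<Sum>\<pi>\<in>permutations_of_set (T - {i}). m (\<pi> @ [i])) = fact c * (u T - u (T - {i}))"
  proof -
    have "m (\<pi> @ [i]) = u T - u (T - {i})" if "\<pi> \<in> permutations_of_set (T - {i})" for \<pi>
      using that assms(2)
      by (simp add: m_def Prc_snoc(2) permutations_of_set_def insert_absorb)
    then show ?thesis
      using assms by (simp add: c_def)
  qed
  have last_j: "(\<Sum>\<pi>\<in>permutations_of_set (T - {j}). m (\<pi> @ [j])) = fact c * shapley (T - {j}) u i"
    if "j \<in> T - {i}" for j
  proof -
    have "m (\<pi> @ [j]) = m \<pi>" if "\<pi> \<in> permutations_of_set (T - {j})" for \<pi>
    proof -
      have "i \<in> set \<pi>"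
        using that \<open>j \<in> T - {i}\<close> assms(2) permutations_of_setD(1)[OF that] by blast
      then show ?thesis by (simp add: m_def Prc_snoc(1))
    qed
    \<comment> \<open>The factor \<open>fact c\<close> cancels the normalisation
      \<open>1 / fact c\<close> inside the Shapley value of the subgame.\<close>
    then show ?thesis
      using that assms(1) by (simp add: shapley_def m_def c_def)
  qed
  have "shapley T u i = 1 / fact (card T) *
          (\<Sum>j\<in>T. \<Sum>\<pi>\<in>permutations_of_set (T - {j}). m (\<pi> @ [j]))"
    using sum_permutations_of_set_snoc[of T m] assms by (auto simp: shapley_def m_def)
  also have "\<dots> = 1 / fact (card T) *
          (fact c * (u T - u (T - {i}) + (\<Sum>j\<in>T - {i}. shapley (T - {j}) u i)))"
    by (simp add: sum.remove[OF assms] last_i last_j sum_distrib_left distrib_left)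
  also have "\<dots> = 1 / of_nat (card T) *
          (u T - u (T - {i}) + (\<Sum>j\<in>T - {i}. shapley (T - {j}) u i))"
    \<comment> \<open>From \<open>fact (Suc c) = Suc c * fact c\<close>, cancelling
      \<open>fact c\<close> leaves the factor \<open>1 / card T\<close>.\<close>
    unfolding c fact_Suc by simp
  finally show ?thesis .
qed

text \<open>The Shapley value is an average over orderings, and \<open>Prc\<close> never contains
  \<open>i\<close>, so coalitions inside \<open>T - {i}\<close> are the only ones to check.\<close>

lemma shapley_constant_marginal:
  assumes "finite T" and "\<And>S. S \<subseteq> T - {i} \<Longrightarrow> u (insert i S) - u S = c"
  shows "shapley T u i = c"
proof -
  have "u (Prc \<pi> i \<union> {i}) - u (Prc \<pi> i) = c" if "\<pi> \<in> permutations_of_set T" for \<pi>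
    using assms(2)[of "Prc \<pi> i"] Prc_subset[of \<pi> i] that by (simp add: permutations_of_set_def)
  then show ?thesis
    using assms(1) by (simp add: shapley_def)
qed

text \<open>Removing a player may bring the total weight down to at most \<open>E\<close> or leave a
  singleton, so the recursion can meet every case of \<open>phi_dual\<close>; this lemma treats them
  uniformly.\<close>

lemma phi_dual_eq_shapley:
  assumes "finite R" and "R \<subseteq> N" and "i \<in> R" and "E > 0" and "\<And>k. k \<in> R \<Longrightarrow> w k \<ge> 0"
  shows "phi_dual N E w R i = shapley R (restricted_game E w) i"
proof (cases "card R \<ge> 2")
  case True
  have "shapley R (restricted_game E w) i = w i" if le: "(\<Sum>k\<in>R. w k) \<le> E"
  proof (rule shapley_constant_marginal[OF assms(1)])
    \<comment> \<open>With nonnegative weights no subset of \<open>R\<close> weighs more than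
      \<open>R\<close>, so the cap \<open>E\<close> never cuts anything off and the game is additive
      on \<open>R\<close>.\<close>
    fix S assume S: "S \<subseteq> R - {i}"
    have additive: "restricted_game E w A = (\<Sum>k\<in>A. w k)" if "A \<subseteq> R" for A
      using sum_mono2[OF assms(1) that, of w] assms(5) le by (auto simp: restricted_game_def)
    have "finite S" using S assms(1) by (meson finite_Diff finite_subset)
    then show "restricted_game E w (insert i S) - restricted_game E w S = w i"
      using S assms(3) by (subst (1 2) additive) (auto simp: subset_Diff_insert)
  qed
  with True show ?thesis by (auto simp: phi_dual_def)
next
  case False
  moreover have "card R > 0" using assms(1,3) by (auto simp: card_gt_0_iff)
  ultimately have "card R = 1" by simp
  with assms(3) have R: "R = {i}" by (auto simp: card_1_singleton_iff)
  \<comment> \<open>The only coalition without \<open>i\<close> is empty, and its value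
    \<open>min E 0\<close> is 0 because \<open>E\<close> is positive.\<close>
  have "shapley R (restricted_game E w) i = min E (w i)"
    using assms(4) by (intro shapley_constant_marginal) (auto simp: R restricted_game_def)
  moreover have "phi_dual N E w R i = min E (w i)"
    using dual_bankruptcy_eq[of E "{i}" N w] assms(2,4) by (simp add: phi_dual_def R)
  ultimately show ?thesis by simp
qed

theorem theorem5p2:
  fixes n :: nat and E :: rat and w :: "nat \<Rightarrow> rat" and N :: "nat set"
    and vd :: "nat set \<Rightarrow> rat" and S' :: "nat set" and i :: nat
  defines "N \<equiv> {1..n}"
    and "vd \<equiv> dual_game N (bankruptcy N E w)"
  assumes "E > 0"
    and "\<And>k. k \<in> N \<Longrightarrow> w k > 0"
    and "E < (\<Sum>k\<in>N. w k)"
    and "S' \<subseteq> N"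
    and "card S' \<ge> 2"
    and "(\<Sum>k\<in>S'. w k) > E"
    and "i \<in> S'"
  shows "phi_dual N E w S' i =
           1 / of_nat (card S') *
             (vd S' - vd (S' - {i}) + (\<Sum>j\<in>S' - {i}. phi_dual N E w (S' - {j}) i))"
proof -
  have fin: "finite S'"
    using \<open>S' \<subseteq> N\<close> unfolding N_def by (rule finite_subset) simp
  have phi: "phi_dual N E w R i = shapley R (restricted_game E w) i" if "R \<subseteq> S'" "i \<in> R" for R
  proof (rule phi_dual_eq_shapley)
    show "w k \<ge> 0" if "k \<in> R" for k
      using that \<open>R \<subseteq> S'\<close> assms(4,6) by (meson less_imp_le subsetD)
  qed (use that assms(3,6) finite_subset[OF that(1) fin] in auto)
  have vd: "vd R = restricted_game E w R" if "R \<subseteq> S'" for R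
    using dual_bankruptcy_eq[of E R N w] that assms(3,6) by (auto simp: vd_def restricted_game_def)
  \<comment> \<open>Rewriting by \<open>phi\<close> needs \<open>i\<close> in
    \<open>S' - {j}\<close>, which comes from the range of the summation index.\<close>
  have "(\<Sum>j\<in>S' - {i}. phi_dual N E w (S' - {j}) i) =
          (\<Sum>j\<in>S' - {i}. shapley (S' - {j}) (restricted_game E w) i)"
    using \<open>i \<in> S'\<close> by (intro sum.cong phi) auto
  then show ?thesis
    using shapley_recursion[OF fin \<open>i \<in> S'\<close>, of "restricted_game E w"] \<open>i \<in> S'\<close>
    by (simp only: phi vd subset_refl Diff_subset)
qed

end
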